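(* Suppose that $\mu_X$ and $\mu_Y$ are probability measures and that there exist $j_0\in\mathcal{J}$ and $k_0\in\mathcal{K}$ such that $p_{j_0}^X(x)=p_{k_0}^Y(y)=1$ for all $x\in\mathcal{X}$ and $y\in\mathcal{Y}$. Let $n\in\mathbb{N}$, let $(a_{jk})_{j\in\mathcal{J}\setminus\{j_0\},k\in\mathcal{K}\setminus\{k_0\}}$ be a deterministic square-summable array of real numbers, let $(\xi_{jk})_{j\in\mathcal{J}\setminus\{j_0\},k\in\mathcal{K}\setminus\{k_0\}}$ be an independent and identically distributed array of Rademacher random variables (taking values $1$ and $-1$ with probability $1/2$ each), and define a random element of $L^2(\mu)$ by $$p:=p_{j_0k_0}+\sum_{j\in\mathcal{J}\setminus\{j_0\},k\in\mathcal{K}\setminus\{k_0\}}a_{jk}\xi_{jk}p_{jk}.$$ Assume $\{p\in\mathcal{F}\}$ is an event, of positive probability, and define $f$ to be a random element of $\mathcal{F}$ that has the same distribution as $p\,|\,\{p\in\mathcal{F}\}$. Writing $\mathbb{E}\mathbb{P}_f^{\otimes n}$ for the resulting mixture distribution on $(\mathcal{X}\times\mathcal{Y})^n$ and $\mathbb{P}_{p_{j_0k_0}}$ for the distribution on $\mathcal{X}\times\mathcal{Y}$ with density $p_{j_0k_0}$, we have that $$d_{\mathrm{TV}}^2\bigl(\mathbb{P}_{p_{j_0k_0}}^{\otimes n},\mathbb{E}\mathbb{P}_f^{\otimes n}\bigr)\le\frac{\exp\bigl(\frac{(n+1)^2}{2}\sum_{j\in\mathcal{J}\setminus\{j_0\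},k\in\mathcal{K}\setminus\{k_0\}}a_{jk}^4\bigr)}{4\mathbb{P}(p\in\mathcal{F})^2}-\frac14.$$
   Context: Let $(\mathcal{X},\mathcal{A},\mu_X)$ and $(\mathcal{Y},\mathcal{B},\mu_Y)$ be separable measure spaces (a measure space $(\mathcal{Z},\mathcal{C},\nu)$ is separable if $\mathcal{C}$, equipped with the pseudo-metric $d(A,B)=\nu(A\triangle B)$, has a countable dense subset). $(p_j^X)_{j\in\mathcal{J}}$ and $(p_k^Y)_{k\in\mathcal{K}}$ are orthonormal bases of $L^2(\mu_X)$ and $L^2(\mu_Y)$ (real-valued functions), with $\mathcal{J},\mathcal{K}$ countable; $\mu:=\mu_X\otimes\mu_Y$ and $p_{jk}(x,y):=p_j^X(x)p_k^Y(y)$. $\mathcal{F}$ is the set of $f\in L^2(\mu)$ with $f\ge0$ $\mu$-a.e. and $\int f\,d\mu=1$. For $f\in\mathcal{F}$, $\mathbb{P}_f$ is the distribution on $\mathcal{X}\times\mathcal{Y}$ with density $f$ with respect to $\mu$; the mixture $\mathbb{E}\mathbb{P}_f^{\otimes n}$ has density $(x_1,y_1,\ldots,x_n,y_n)\mapsto\mathbb{E}\{f(x_1,y_1)\cdots f(x_n,y_n)\}$ with respect to $\mu^{\otimes n}$. $d_{\mathrm{TV}}(\nu_1,\nu_2):=\sup_C|\nu_1(C)-\nu_2(C)|$ over measurable sets $C$. *)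

theory Defs
  imports "HOL-Probability.Probability"
begin

definition separable_measure :: "'z measure \<Rightarrow> bool" where
  "separable_measure M \<longleftrightarrow>
     (\<exists>D. countable D \<and> D \<subseteq> sets M \<and>
        (\<forall>A\<in>sets M. \<forall>e::real. e > 0 \<longrightarrow> (\<exists>B\<in>D. emeasure M (sym_diff A B) < ennreal e)))"

text \<open>Elements of \<open>L\<^sup>2\<close> are represented by square-integrable functions, without passing to
  equivalence classes; all notions below are invariant under almost everywhere equality.\<close>

definition L2 :: "'z measure \<Rightarrow> ('z \<Rightarrow> real) set" where
  "L2 M = {f \<in> borel_measurable M. integrable M (\<lambda>z. (f z)\<^sup>2)}"

definition L2_inner :: "'z measure \<Rightarrow> ('z \<Rightarrow> real) \<Rightarrow> ('z \<Rightarrow> real) \<Rightarrow> real" where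
  "L2_inner M f g = (\<integral>z. f z * g z \<partial>M)"

definition L2_seminorm :: "'z measure \<Rightarrow> ('z \<Rightarrow> real) \<Rightarrow> real" where
  "L2_seminorm M f = sqrt (L2_inner M f f)"

definition orthonormal_basis_L2 :: "'z measure \<Rightarrow> 'i set \<Rightarrow> ('i \<Rightarrow> 'z \<Rightarrow> real) \<Rightarrow> bool" where
  "orthonormal_basis_L2 M I b \<longleftrightarrow>
     (\<forall>i\<in>I. b i \<in> L2 M) \<and>
     (\<forall>i\<in>I. \<forall>j\<in>I. L2_inner M (b i) (b j) = (if i = j then 1 else 0)) \<and>
     (\<forall>g\<in>L2 M. \<forall>e>0. \<exists>S c. finite S \<and> S \<subseteq> I \<and>
        L2_seminorm M (\<lambda>z. g z - (\<Sum>i\<in>S. c i * b i z)) < e)"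

text \<open>Unconditional convergence in \<open>L\<^sup>2\<close> of \<open>\<Sum>i\<in>I. u i\<close> to \<open>g\<close>, along the net of finite
  subsets of \<open>I\<close>.\<close>

definition has_L2_sum :: "'z measure \<Rightarrow> ('i \<Rightarrow> 'z \<Rightarrow> real) \<Rightarrow> 'i set \<Rightarrow> ('z \<Rightarrow> real) \<Rightarrow> bool" where
  "has_L2_sum M u I g \<longleftrightarrow> g \<in> L2 M \<and> (\<forall>i\<in>I. u i \<in> L2 M) \<and>
     ((\<lambda>S. L2_seminorm M (\<lambda>z. (\<Sum>i\<in>S. u i z) - g z)) \<longlongrightarrow> 0) (finite_subsets_at_top I)"

definition L2_open :: "'z measure \<Rightarrow> ('z \<Rightarrow> real) set \<Rightarrow> bool" where
  "L2_open M U \<longleftrightarrow> U \<subseteq> L2 M \<and>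
     (\<forall>f\<in>U. \<exists>e>0. \<forall>g\<in>L2 M. L2_seminorm M (\<lambda>z. g z - f z) < e \<longrightarrow> g \<in> U)"

text \<open>The Borel sigma-algebra of \<open>L\<^sup>2\<close>; a random element of \<open>L\<^sup>2\<close> is a measurable map into it.\<close>

definition L2_borel :: "'z measure \<Rightarrow> ('z \<Rightarrow> real) measure" where
  "L2_borel M = sigma (L2 M) {U. L2_open M U}"

definition L2_densities :: "'z measure \<Rightarrow> ('z \<Rightarrow> real) set" where
  "L2_densities M = {f \<in> L2 M. (AE z in M. f z \<ge> 0) \<and> (\<integral>z. f z \<partial>M) = 1}"

definition tensor :: "('i \<Rightarrow> 'x \<Rightarrow> real) \<Rightarrow> ('k \<Rightarrow> 'y \<Rightarrow> real) \<Rightarrow> 'i \<Rightarrow> 'k \<Rightarrow> 'x \<times> 'y \<Rightarrow> real" where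
  "tensor bX bY j k z = bX j (fst z) * bY k (snd z)"

definition rademacher :: "'w measure \<Rightarrow> ('w \<Rightarrow> real) \<Rightarrow> bool" where
  "rademacher P X \<longleftrightarrow> X \<in> borel_measurable P \<and>
     measure P {w \<in> space P. X w = 1} = 1/2 \<and> measure P {w \<in> space P. X w = - 1} = 1/2"

definition density_law :: "'z measure \<Rightarrow> ('z \<Rightarrow> real) \<Rightarrow> 'z measure" where
  "density_law M f = density M (\<lambda>z. ennreal (f z))"

definition power_law :: "nat \<Rightarrow> 'z measure \<Rightarrow> (nat \<Rightarrow> 'z) measure" where
  "power_law n N = PiM {..<n} (\<lambda>_. N)"

text \<open>The mixture \<open>C \<mapsto> E[P\<^sub>f\<^sup>n(C)]\<close>. Being defined through the monadic bind, it
  does not depend on the representatives chosen for the values of \<open>f\<close>. For jointly measurable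
  representatives its density is the expected product, see \<open>mixture_law_eq_density\<close> below.\<close>

definition mixture_law ::
  "'v measure \<Rightarrow> nat \<Rightarrow> 'z measure \<Rightarrow> ('v \<Rightarrow> 'z \<Rightarrow> real) \<Rightarrow> (nat \<Rightarrow> 'z) measure" where
  "mixture_law Q n M f = Giry_Monad.bind Q (\<lambda>v. power_law n (density_law M (f v)))"

definition tv_dist :: "'z measure \<Rightarrow> 'z measure \<Rightarrow> real" where
  "tv_dist N1 N2 = (SUP C\<in>sets N1. \<bar>measure N1 C - measure N2 C\<bar>)"

lemma prob_space_density_law:
  assumes "finite_measure M" "f \<in> L2_densities M"
  shows "prob_space (density_law M f)"
proof
  interpret finite_measure M by fact
  from assms(2) have f: "f \<in> borel_measurable M" "integrable M (\<lambda>z. (f z)\<^sup>2)"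
    "AE z in M. f z \<ge> 0" "(\<integral>z. f z \<partial>M) = 1"
    by (auto simp: L2_densities_def L2_def)
  have "integrable M f" using f(4) not_integrable_integral_eq by fastforce
  then have "(\<integral>\<^sup>+z. ennreal (f z) \<partial>M) = 1"
    using f by (simp add: nn_integral_eq_integral)
  then show "emeasure (density_law M f) (space (density_law M f)) = 1"
    using f by (simp add: density_law_def emeasure_density cong: nn_integral_cong)
qed

lemma power_law_density_law:
  assumes "prob_space M" "f \<in> L2_densities M"
  shows "power_law n (density_law M f) =
           density (power_law n M) (\<lambda>z. \<Prod>i<n. ennreal (f (z i)))"
proof -
  interpret M: prob_space M by fact
  interpret N: prob_space "density_law M f"
    using assms by (intro prob_space_density_law) (auto simp: M.finite_measure_axioms)
  interpret PM: product_sigma_finite "\<lambda>_::nat. M" ..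
  interpret PN: product_sigma_finite "\<lambda>_::nat. density_law M f" ..
  have [measurable]: "f \<in> borel_measurable M"
    using assms by (auto simp: L2_densities_def L2_def)
  have sN: "sets (density_law M f) = sets M" by (simp add: density_law_def)
  have "density (power_law n M) (\<lambda>z. \<Prod>i<n. ennreal (f (z i))) =
          PiM {..<n} (\<lambda>_. density_law M f)"
  proof (rule PN.PiM_eqI)
    show "sets (density (power_law n M) (\<lambda>z. \<Prod>i<n. ennreal (f (z i)))) =
        sets (PiM {..<n} (\<lambda>_. density_law M f))"
      by (simp add: power_law_def sN cong: sets_PiM_cong)
  next
    fix A :: "nat \<Rightarrow> 'a set" assume "\<And>i. i \<in> {..<n} \<Longrightarrow> A i \<in> sets (density_law M f)"
    then have A[measurable]: "\<And>i. i \<in> {..<n} \<Longrightarrow> A i \<in> sets M" by (simp add: sN)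
    have AP: "Pi\<^sub>E {..<n} A \<in> sets (PiM {..<n} (\<lambda>_. M))"
      using A by (intro sets_PiM_I_finite) auto
    have "emeasure (density (power_law n M) (\<lambda>z. \<Prod>i<n. ennreal (f (z i)))) (Pi\<^sub>E {..<n} A)
        = (\<integral>\<^sup>+z. (\<Prod>i<n. ennreal (f (z i))) * indicator (Pi\<^sub>E {..<n} A) z \<partial>PiM {..<n} (\<lambda>_. M))"
      unfolding power_law_def using AP by (subst emeasure_density) auto
    also have "\<dots> = (\<integral>\<^sup>+z. (\<Prod>i<n. ennreal (f (z i)) * indicator (A i) (z i)) \<partial>PiM {..<n} (\<lambda>_. M))"
    proof (rule nn_integral_cong)
      fix z assume "z \<in> space (PiM {..<n} (\<lambda>_. M))"
      then have "z \<in> extensional {..<n}" by (auto simp: space_PiM PiE_def)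
      then have "(indicator (Pi\<^sub>E {..<n} A) z :: ennreal) = (\<Prod>i<n. indicator (A i) (z i))"
        by (auto simp: indicator_def PiE_def Pi_def prod_zero_iff)
      then show "(\<Prod>i<n. ennreal (f (z i))) * indicator (Pi\<^sub>E {..<n} A) z =
          (\<Prod>i<n. ennreal (f (z i)) * indicator (A i) (z i))"
        by (simp add: prod.distrib)
    qed
    also have "\<dots> = (\<Prod>i<n. \<integral>\<^sup>+x. ennreal (f x) * indicator (A i) x \<partial>M)"
      by (rule PM.product_nn_integral_prod) auto
    also have "\<dots> = (\<Prod>i<n. emeasure (density_law M f) (A i))"
      by (intro prod.cong) (auto simp: density_law_def emeasure_density)
    finally show "emeasure (density (power_law n M) (\<lambda>z. \<Prod>i<n. ennreal (f (z i))))
        (Pi\<^sub>E {..<n} A) = (\<Prod>i<n. emeasure (density_law M f) (A i))" .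
  qed auto
  then show ?thesis by (simp add: power_law_def)
qed

lemma mixture_law_eq_density:
  assumes "prob_space Q" "prob_space M"
    and f: "\<And>v. v \<in> space Q \<Longrightarrow> f v \<in> L2_densities M"
    and meas[measurable]: "(\<lambda>(v, z). f v z) \<in> borel_measurable (Q \<Otimes>\<^sub>M M)"
  shows "mixture_law Q n M f =
           density (power_law n M) (\<lambda>z. \<integral>\<^sup>+v. (\<Prod>i<n. ennreal (f v (z i))) \<partial>Q)"
proof -
  interpret Q: prob_space Q by fact
  interpret M: prob_space M by fact
  interpret R: prob_space "power_law n M"
    unfolding power_law_def by (intro prob_space_PiM assms)
  interpret QR: pair_sigma_finite Q "power_law n M" ..
  let ?K = "\<lambda>v. power_law n (density_law M (f v))"
  let ?h = "\<lambda>v z. \<Prod>i<n. ennreal (f v (z i))"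
  have K: "?K v = density (power_law n M) (?h v)" if "v \<in> space Q" for v
    using that f by (intro power_law_density_law assms) auto
  have h[measurable]: "(\<lambda>(v, z). ?h v z) \<in> borel_measurable (Q \<Otimes>\<^sub>M power_law n M)"
  proof -
    have "(\<lambda>vz. ennreal (f (fst vz) (snd vz i))) \<in> borel_measurable (Q \<Otimes>\<^sub>M power_law n M)"
      if "i < n" for i
    proof -
      have "(\<lambda>vz. (fst vz, snd vz i)) \<in> (Q \<Otimes>\<^sub>M power_law n M) \<rightarrow>\<^sub>M (Q \<Otimes>\<^sub>M M)"
        unfolding power_law_def using that
        by (intro measurable_Pair measurable_fst
              measurable_compose[OF measurable_snd measurable_component_singleton]) auto
      from measurable_compose[OF this meas] show ?thesis by simp
    qed
    then show ?thesis by (auto simp: case_prod_beta)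
  qed
  have hv: "?h v \<in> borel_measurable (power_law n M)" if "v \<in> space Q" for v
    using measurable_Pair2[OF h that] by simp
  have eK: "emeasure (?K v) A = (\<integral>\<^sup>+z. ?h v z * indicator A z \<partial>power_law n M)"
    if "v \<in> space Q" "A \<in> sets (power_law n M)" for v A
    using that hv by (simp add: K emeasure_density)
  have Km: "?K \<in> Q \<rightarrow>\<^sub>M subprob_algebra (power_law n M)"
  proof (rule measurable_subprob_algebra)
    fix v assume v: "v \<in> space Q"
    have "prob_space (?K v)" unfolding power_law_def
      by (intro prob_space_PiM prob_space_density_law f v M.finite_measure_axioms)
    then show "subprob_space (?K v)" by (rule prob_space_imp_subprob_space)
    show "sets (?K v) = sets (power_law n M)" by (simp add: K[OF v])
  next
    fix A assume [measurable]: "A \<in> sets (power_law n M)"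
    have "(\<lambda>v. \<integral>\<^sup>+z. ?h v z * indicator A z \<partial>power_law n M) \<in> borel_measurable Q"
      by (rule R.borel_measurable_nn_integral) (use h in measurable)
    then show "(\<lambda>v. emeasure (?K v) A) \<in> borel_measurable Q"
      by (subst measurable_cong) (auto simp: eK)
  qed
  show ?thesis
  proof (rule measure_eqI)
    show s: "sets (mixture_law Q n M f) =
        sets (density (power_law n M) (\<lambda>z. \<integral>\<^sup>+v. ?h v z \<partial>Q))"
      unfolding mixture_law_def
      by (subst sets_bind[where N = "power_law n M"]) (auto simp: K Q.not_empty)
    fix A assume "A \<in> sets (mixture_law Q n M f)"
    with s have A[measurable]: "A \<in> sets (power_law n M)" by simp
    have "emeasure (mixture_law Q n M f) A = (\<integral>\<^sup>+v. emeasure (?K v) A \<partial>Q)"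
      unfolding mixture_law_def by (rule emeasure_bind[OF Q.not_empty Km A])
    also have "\<dots> = (\<integral>\<^sup>+v. (\<integral>\<^sup>+z. ?h v z * indicator A z \<partial>power_law n M) \<partial>Q)"
      by (intro nn_integral_cong) (simp add: eK)
    also have "\<dots> = (\<integral>\<^sup>+z. (\<integral>\<^sup>+v. ?h v z * indicator A z \<partial>Q) \<partial>power_law n M)"
      by (rule QR.Fubini'[symmetric]) (use h in measurable)
    also have "\<dots> = (\<integral>\<^sup>+z. (\<integral>\<^sup>+v. ?h v z \<partial>Q) * indicator A z \<partial>power_law n M)"
    proof (rule nn_integral_cong)
      fix z assume "z \<in> space (power_law n M)"
      from measurable_Pair1[OF h this] have "(\<lambda>v. ?h v z) \<in> borel_measurable Q" by simp
      then show "(\<integral>\<^sup>+v. ?h v z * indicator A z \<partial>Q) = (\<integral>\<^sup>+v. ?h v z \<partial>Q) * indicator A z"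
        by (rule nn_integral_multc)
    qed
    also have "\<dots> = emeasure (density (power_law n M) (\<lambda>z. \<integral>\<^sup>+v. ?h v z \<partial>Q)) A"
    proof (rule emeasure_density[symmetric, OF _ A])
      have "(\<lambda>(z, v). ?h v z) \<in> borel_measurable (power_law n M \<Otimes>\<^sub>M Q)"
        using measurable_compose[OF measurable_pair_swap' h] by (simp add: case_prod_beta)
      then show "(\<lambda>z. \<integral>\<^sup>+v. ?h v z \<partial>Q) \<in> borel_measurable (power_law n M)"
        by (rule Q.borel_measurable_nn_integral)
    qed
    finally show "emeasure (mixture_law Q n M f) A =
        emeasure (density (power_law n M) (\<lambda>z. \<integral>\<^sup>+v. ?h v z \<partial>Q)) A" .
  qed
qed

end

theory Submission
  imports Defs
begin

text \<open>The proof is the second moment method for a mixture alternative. Write \<open>R = \<mu>\<^sup>n\<close>, which is the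
  null law because \<open>p\<^bsub>j0k0\<^esub>\<close> is identically \<open>1\<close>. If the mixture has density \<open>g\<close> with respect
  to \<open>R\<close>, then the difference of the two laws on \<open>C\<close> is the inner product of \<open>g - 1\<close> with
  \<open>1\<^sub>C - 1/2\<close>, a function of norm \<open>1/2\<close>; the Cauchy-Schwarz inequality gives
  \<open>TV\<^sup>2 \<le> (\<integral> g\<^sup>2 dR - 1) / 4\<close> (\<open>tv_dist_le_second_moment\<close>).

  The second moment is an integral over two independent copies \<open>f, f'\<close> of the random density:
  \<open>\<integral> g\<^sup>2 dR = E E' \<langle>f, f'\<rangle>\<^sup>n\<close> (\<open>mixture_density\<close>). Usually one exchanges integrals in
  \<open>g = E \<Prod> f(z\<^sub>i)\<close>, but a random element of \<open>L\<^sup>2\<close> need not be jointly measurable in the random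
  parameter and in \<open>z\<close>. Instead \<open>g\<close> is taken to be a Radon-Nikodym derivative, and the formula
  is obtained by integrating first \<open>g\<close> and then each product \<open>\<Prod> f(z\<^sub>i)\<close> against the mixture,
  which is an integral of kernels. Only measurability of the kernel is needed for this, and it
  follows from continuity of the maps \<open>u \<mapsto> \<langle>u, 1\<^sub>A\<rangle>\<close> on \<open>L\<^sup>2\<close> (\<open>measurable_power_law\<close>).

  The mixture depends on \<open>f\<close> only through its distribution (\<open>mixture_law_cong_distr\<close>), so \<open>f\<close> may
  be replaced by \<open>p\<close> under the conditional probability given the event \<open>E = {p \<in> F}\<close>. For outcomes
  \<open>w, w'\<close> in \<open>E\<close>, both densities are nonnegative with integral \<open>1\<close>, and orthonormality gives
  \<open>0 \<le> \<langle>p w, p w'\<rangle> = 1 + \<Sum> a\<^sup>2 \<xi>(w) \<xi>(w') \<le> exp (\<Sum> a\<^sup>2 \<xi>(w) \<xi>(w'))\<close>. With \<open>w\<close> held fixed, the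
  exponent is a Rademacher series in \<open>w'\<close> with coefficients \<open>\<plusminus> a\<^sup>2\<close>, so it is sub-Gaussian
  (\<open>rademacher_series_subgaussian\<close>) and its \<open>n\<close>-th multiple has exponential moment at most
  \<open>exp (n\<^sup>2/2 \<Sum> a\<^sup>4)\<close>, whatever the signs \<open>\<xi>(w)\<close> are. Conditioning costs a factor
  \<open>1 / P(E)\<close> in the inner integral only, and the outer integral is an average. This gives
  \<open>TV\<^sup>2 \<le> (exp (n\<^sup>2/2 \<Sum> a\<^sup>4) / P(E) - 1) / 4\<close> (\<open>rademacher_mixture_tv_bound\<close>), which implies the
  stated bound.\<close>

section \<open>Square-integrable functions\<close>

lemma L2_measurable: "f \<in> L2 M \<Longrightarrow> f \<in> borel_measurable M"
  by (simp add: L2_def)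

lemma L2_integrable_mult:
  assumes "f \<in> L2 M" "g \<in> L2 M"
  shows "integrable M (\<lambda>z. f z * g z)"
proof (rule Bochner_Integration.integrable_bound)
  show "integrable M (\<lambda>z. (f z)\<^sup>2 + (g z)\<^sup>2)" using assms by (auto simp: L2_def)
  show "(\<lambda>z. f z * g z) \<in> borel_measurable M" using assms by (auto simp: L2_def)
  have "\<bar>x * y\<bar> \<le> x\<^sup>2 + y\<^sup>2" for x y :: real
  proof -
    have "0 \<le> (\<bar>x\<bar> - \<bar>y\<bar>)\<^sup>2" by simp
    then have "2 * (\<bar>x\<bar> * \<bar>y\<bar>) \<le> x\<^sup>2 + y\<^sup>2" by (simp add: power2_diff)
    then show ?thesis unfolding abs_mult using mult_nonneg_nonneg[of "\<bar>x\<bar>" "\<bar>y\<bar>"] by linarith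
  qed
  then show "AE z in M. norm (f z * g z) \<le> norm ((f z)\<^sup>2 + (g z)\<^sup>2)" by auto
qed

lemma L2_add:
  assumes "f \<in> L2 M" "g \<in> L2 M"
  shows "(\<lambda>z. f z + g z) \<in> L2 M"
  using assms L2_integrable_mult[OF assms]
  by (auto simp: L2_def power2_sum mult.assoc)

lemma L2_scale:
  assumes "f \<in> L2 M" shows "(\<lambda>z. c * f z) \<in> L2 M"
  using assms by (auto simp: L2_def power_mult_distrib)

lemma L2_diff:
  assumes "f \<in> L2 M" "g \<in> L2 M"
  shows "(\<lambda>z. f z - g z) \<in> L2 M"
  using L2_add[OF assms(1) L2_scale[OF assms(2), of "-1"]] by simp

lemma L2_sum:
  assumes "\<And>i. i \<in> S \<Longrightarrow> f i \<in> L2 M"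
  shows "(\<lambda>z. \<Sum>i\<in>S. f i z) \<in> L2 M"
proof (cases "finite S")
  case True
  then show ?thesis using assms
  proof (induction S)
    case empty
    show ?case by (simp add: L2_def)
  next
    case (insert i S)
    then show ?case using L2_add[of "f i" M "\<lambda>z. \<Sum>i\<in>S. f i z"] by simp
  qed
qed (simp add: L2_def)

lemma (in finite_measure) L2_bounded:
  fixes h :: "'a \<Rightarrow> real"
  assumes [measurable]: "h \<in> borel_measurable M" and "\<And>z. \<bar>h z\<bar> \<le> B"
  shows "h \<in> L2 M"
proof -
  have "norm ((h z)\<^sup>2) \<le> B\<^sup>2" for z
    using power_mono[OF assms(2)[of z], of 2] by simp
  then have "integrable M (\<lambda>z. (h z)\<^sup>2)"
    by (intro integrable_const_bound[of _ "B\<^sup>2"]) simp_all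
  then show ?thesis by (simp add: L2_def)
qed

lemma (in finite_measure) L2_integrable: "f \<in> L2 M \<Longrightarrow> integrable M f"
  by (rule square_integrable_imp_integrable) (simp_all add: L2_def)

lemma L2_inner_commute: "L2_inner M f g = L2_inner M g f"
  by (simp add: L2_inner_def mult.commute)

lemma L2_inner_self_nonneg: "0 \<le> L2_inner M f f"
  by (simp add: L2_inner_def)

lemma L2_inner_diff_left:
  assumes "f \<in> L2 M" "g \<in> L2 M" "h \<in> L2 M"
  shows "L2_inner M (\<lambda>z. f z - g z) h = L2_inner M f h - L2_inner M g h"
  using assms by (simp add: L2_inner_def left_diff_distrib L2_integrable_mult)

lemma L2_inner_diff_right:
  assumes "f \<in> L2 M" "g \<in> L2 M" "h \<in> L2 M"
  shows "L2_inner M h (\<lambda>z. f z - g z) = L2_inner M h f - L2_inner M h g"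
  using L2_inner_diff_left[OF assms] by (simp add: L2_inner_commute)

lemma L2_inner_sum_sum:
  assumes "\<And>i. i \<in> S \<Longrightarrow> f i \<in> L2 M" "\<And>i. i \<in> T \<Longrightarrow> g i \<in> L2 M"
  shows "L2_inner M (\<lambda>z. \<Sum>i\<in>S. f i z) (\<lambda>z. \<Sum>i\<in>T. g i z) =
    (\<Sum>i\<in>S. \<Sum>j\<in>T. L2_inner M (f i) (g j))"
  using assms by (simp add: L2_inner_def sum_product L2_integrable_mult)

lemma L2_Cauchy_Schwarz:
  assumes "f \<in> L2 M" "g \<in> L2 M"
  shows "\<bar>L2_inner M f g\<bar> \<le> L2_seminorm M f * L2_seminorm M g"
proof -
  have [measurable]: "f \<in> borel_measurable M" "g \<in> borel_measurable M"
    using assms by (auto simp: L2_def)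
  have I: "integrable M (\<lambda>z. \<bar>f z\<bar> * \<bar>g z\<bar>)"
    using integrable_abs[OF L2_integrable_mult[OF assms]] by (simp add: abs_mult)
  have sq: "(\<integral>\<^sup>+z. (ennreal \<bar>h z\<bar>)\<^sup>2 \<partial>M) = ennreal (L2_inner M h h)" if "h \<in> L2 M" for h
    using L2_integrable_mult[OF that that] unfolding L2_inner_def
    by (subst nn_integral_eq_integral[symmetric])
       (auto simp: ennreal_power power2_eq_square[symmetric])
  have "(ennreal (\<integral>z. \<bar>f z\<bar> * \<bar>g z\<bar> \<partial>M))\<^sup>2 = (\<integral>\<^sup>+z. ennreal \<bar>f z\<bar> * ennreal \<bar>g z\<bar> \<partial>M)\<^sup>2"
    using I by (subst nn_integral_eq_integral[symmetric]) (auto simp: ennreal_mult)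
  also have "\<dots> \<le> (\<integral>\<^sup>+z. (ennreal \<bar>f z\<bar>)\<^sup>2 \<partial>M) * (\<integral>\<^sup>+z. (ennreal \<bar>g z\<bar>)\<^sup>2 \<partial>M)"
    by (rule Cauchy_Schwarz_nn_integral) auto
  also have "\<dots> = ennreal ((L2_seminorm M f * L2_seminorm M g)\<^sup>2)"
    using assms by (simp add: sq L2_seminorm_def L2_inner_self_nonneg power_mult_distrib ennreal_mult)
  finally have "(\<integral>z. \<bar>f z\<bar> * \<bar>g z\<bar> \<partial>M)\<^sup>2 \<le> (L2_seminorm M f * L2_seminorm M g)\<^sup>2"
    by (subst (asm) ennreal_power) auto
  then have "(\<integral>z. \<bar>f z\<bar> * \<bar>g z\<bar> \<partial>M) \<le> L2_seminorm M f * L2_seminorm M g"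
    by (rule power2_le_imp_le) (simp add: L2_seminorm_def L2_inner_self_nonneg)
  moreover have "\<bar>L2_inner M f g\<bar> \<le> (\<integral>z. \<bar>f z\<bar> * \<bar>g z\<bar> \<partial>M)"
    using integral_abs_bound[of M "\<lambda>z. f z * g z"] by (simp add: L2_inner_def abs_mult)
  ultimately show ?thesis by linarith
qed

text \<open>The inner product is continuous along any filter: the error splits into
  \<open>\<langle>u - u', v - v'\<rangle> + \<langle>u', v - v'\<rangle> + \<langle>u - u', v'\<rangle>\<close>, and each term is bounded by the
  Cauchy-Schwarz inequality. The memberships in \<open>L\<^sup>2\<close> are only eventual, since partial sums are
  controlled only over subsets of the index set.\<close>

lemma L2_inner_tendsto:
  assumes "\<forall>\<^sub>F S in F. u S \<in> L2 M" "\<forall>\<^sub>F S in F. v S \<in> L2 M"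
    and L': "u' \<in> L2 M" "v' \<in> L2 M"
    and u: "((\<lambda>S. L2_seminorm M (\<lambda>z. u S z - u' z)) \<longlongrightarrow> 0) F"
    and v: "((\<lambda>S. L2_seminorm M (\<lambda>z. v S z - v' z)) \<longlongrightarrow> 0) F"
  shows "((\<lambda>S. L2_inner M (u S) (v S)) \<longlongrightarrow> L2_inner M u' v') F"
proof (rule Lim_transform2[OF tendsto_const])
  let ?n = "L2_seminorm M"
  let ?b = "\<lambda>S. ?n (\<lambda>z. u S z - u' z) * ?n (\<lambda>z. v S z - v' z) + ?n u' * ?n (\<lambda>z. v S z - v' z)
              + ?n (\<lambda>z. u S z - u' z) * ?n v'"
  have "(?b \<longlongrightarrow> 0 * 0 + ?n u' * 0 + 0 * ?n v') F"
    by (intro tendsto_intros u v)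
  then have b: "(?b \<longlongrightarrow> 0) F" by simp
  show "((\<lambda>S. L2_inner M u' v' - L2_inner M (u S) (v S)) \<longlongrightarrow> 0) F"
  proof (rule tendsto_rabs_zero_cancel, rule tendsto_sandwich[OF _ _ tendsto_const b])
    have "\<bar>L2_inner M u' v' - L2_inner M (u S) (v S)\<bar> \<le> ?b S"
      if L: "u S \<in> L2 M" "v S \<in> L2 M" for S
    proof -
      let ?du = "\<lambda>z. u S z - u' z" and ?dv = "\<lambda>z. v S z - v' z"
      have d: "?du \<in> L2 M" "?dv \<in> L2 M" by (intro L2_diff L L')+
      have "L2_inner M (u S) (v S) - L2_inner M u' v' =
          L2_inner M ?du ?dv + L2_inner M u' ?dv + L2_inner M ?du v'"
        using L L' d by (simp add: L2_inner_diff_left L2_inner_diff_right)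
      moreover have "\<bar>L2_inner M ?du ?dv\<bar> \<le> ?n ?du * ?n ?dv" "\<bar>L2_inner M u' ?dv\<bar> \<le> ?n u' * ?n ?dv"
        "\<bar>L2_inner M ?du v'\<bar> \<le> ?n ?du * ?n v'"
        by (intro L2_Cauchy_Schwarz L' d)+
      ultimately show ?thesis by linarith
    qed
    then show "\<forall>\<^sub>F S in F. \<bar>L2_inner M u' v' - L2_inner M (u S) (v S)\<bar> \<le> ?b S"
      by (intro eventually_mono[OF eventually_conj[OF assms(1,2)]]) auto
  qed simp
qed

lemma space_L2_borel: "space (L2_borel M) = L2 M"
  by (simp add: L2_borel_def space_measure_of_conv)

text \<open>A continuous functional pulls open sets back to \<open>L\<^sup>2\<close>-open sets, and these generate the
  sigma-algebra. All measurability statements about random elements of \<open>L\<^sup>2\<close> below come from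
  here.\<close>

lemma measurable_L2_inner:
  assumes h: "h \<in> L2 M"
  shows "(\<lambda>u. L2_inner M u h) \<in> borel_measurable (L2_borel M)"
proof (rule borel_measurableI)
  fix S :: "real set" assume "open S"
  let ?V = "(\<lambda>u. L2_inner M u h) -` S \<inter> L2 M"
  have "L2_open M ?V" unfolding L2_open_def
  proof (intro conjI ballI)
    fix u assume u: "u \<in> ?V"
    with \<open>open S\<close> obtain e where e: "e > 0" "\<And>y. dist y (L2_inner M u h) < e \<Longrightarrow> y \<in> S"
      by (auto simp: open_dist)
    let ?c = "L2_seminorm M h"
    have c: "0 \<le> ?c" by (simp add: L2_seminorm_def L2_inner_self_nonneg)
    show "\<exists>d>0. \<forall>g\<in>L2 M. L2_seminorm M (\<lambda>z. g z - u z) < d \<longrightarrow> g \<in> ?V"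
    proof (intro exI conjI ballI impI)
      \<comment> \<open>The summand \<open>1\<close> avoids a division by zero when \<open>h\<close> has norm zero.\<close>
      show "e / (?c + 1) > 0" using e c by simp
      fix g assume g: "g \<in> L2 M" "L2_seminorm M (\<lambda>z. g z - u z) < e / (?c + 1)"
      have "\<bar>L2_inner M g h - L2_inner M u h\<bar> \<le> L2_seminorm M (\<lambda>z. g z - u z) * ?c"
        using L2_Cauchy_Schwarz[OF L2_diff h, of g u] g(1) u h by (simp add: L2_inner_diff_left)
      also have "\<dots> \<le> e / (?c + 1) * ?c" using g(2) c by (intro mult_right_mono) auto
      also have "\<dots> < e" using c e by (simp add: field_simps)
      finally show "g \<in> ?V" using g(1) e(2) by (simp add: dist_real_def)
    qed
  qed simp
  then show "(\<lambda>u. L2_inner M u h) -` S \<inter> space (L2_borel M) \<in> sets (L2_borel M)"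
    unfolding space_L2_borel by (auto simp: L2_borel_def L2_open_def)
qed

text \<open>Parseval's identity for two series in the same orthonormal system. The sum is unconditional,
  as it is inherited from the convergence of both series along the finite subsets.\<close>

lemma has_sum_L2_inner:
  assumes e: "\<And>i. i \<in> I \<Longrightarrow> e i \<in> L2 M"
    and on: "\<And>i j. i \<in> I \<Longrightarrow> j \<in> I \<Longrightarrow> L2_inner M (e i) (e j) = (if i = j then 1 else 0)"
    and u: "has_L2_sum M (\<lambda>i z. c i * e i z) I u"
    and v: "has_L2_sum M (\<lambda>i z. d i * e i z) I v"
  shows "((\<lambda>i. c i * d i) has_sum L2_inner M u v) I"
proof -
  have "((\<lambda>S. L2_inner M (\<lambda>z. \<Sum>i\<in>S. c i * e i z) (\<lambda>z. \<Sum>i\<in>S. d i * e i z))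
      \<longlongrightarrow> L2_inner M u v) (finite_subsets_at_top I)"
    using u v unfolding has_L2_sum_def
    by (intro L2_inner_tendsto eventually_finite_subsets_at_top_weakI) (auto intro!: L2_sum)
  moreover have "L2_inner M (\<lambda>z. \<Sum>i\<in>S. c i * e i z) (\<lambda>z. \<Sum>i\<in>S. d i * e i z) = (\<Sum>i\<in>S. c i * d i)"
    if S: "finite S" "S \<subseteq> I" for S
  proof -
    have "L2_inner M (\<lambda>z. c i * e i z) (\<lambda>z. d j * e j z) = (if i = j then c i * d j else 0)"
      if "i \<in> S" "j \<in> S" for i j
    proof -
      have "L2_inner M (\<lambda>z. c i * e i z) (\<lambda>z. d j * e j z) = (\<integral>z. (c i * d j) * (e i z * e j z) \<partial>M)"
        unfolding L2_inner_def by (simp add: mult_ac)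
      also have "\<dots> = (c i * d j) * L2_inner M (e i) (e j)" by (simp add: L2_inner_def)
      finally show ?thesis using on[of i j] that S by (auto simp: subset_eq)
    qed
    moreover have "L2_inner M (\<lambda>z. \<Sum>i\<in>S. c i * e i z) (\<lambda>z. \<Sum>i\<in>S. d i * e i z) =
        (\<Sum>i\<in>S. \<Sum>j\<in>S. L2_inner M (\<lambda>z. c i * e i z) (\<lambda>z. d j * e j z))"
      using S e by (intro L2_inner_sum_sum L2_scale) auto
    ultimately show ?thesis using S by (simp add: sum.delta)
  qed
  ultimately show ?thesis
    unfolding has_sum_def
    by (rule Lim_transform_eventually[OF _ eventually_finite_subsets_at_top_weakI])
qed

lemma L2_inner_product_functions:
  fixes M1 :: "'a measure" and M2 :: "'b measure"
  assumes "prob_space M1" "prob_space M2"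
    and u: "u \<in> L2 M1" "u' \<in> L2 M1" and v: "v \<in> L2 M2" "v' \<in> L2 M2"
  shows "L2_inner (M1 \<Otimes>\<^sub>M M2) (\<lambda>z. u (fst z) * v (snd z)) (\<lambda>z. u' (fst z) * v' (snd z)) =
    L2_inner M1 u u' * L2_inner M2 v v'"
    and "(\<lambda>z. u (fst z) * v (snd z)) \<in> L2 (M1 \<Otimes>\<^sub>M M2)"
proof -
  interpret M1: prob_space M1 by fact
  interpret M2: prob_space M2 by fact
  interpret pair_sigma_finite M1 M2 ..
  have int: "integrable (M1 \<Otimes>\<^sub>M M2) (\<lambda>z. f (fst z) * g (snd z))"
    if f: "integrable M1 f" and g: "integrable M2 g" for f g :: "_ \<Rightarrow> real"
    using f g by (intro Fubini_integrable) (auto simp: abs_mult)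
  have I: "integrable M1 (\<lambda>x. u x * u' x)" "integrable M2 (\<lambda>y. v y * v' y)"
    by (intro L2_integrable_mult u v)+
  have "L2_inner (M1 \<Otimes>\<^sub>M M2) (\<lambda>z. u (fst z) * v (snd z)) (\<lambda>z. u' (fst z) * v' (snd z)) =
      (\<integral>z. (u (fst z) * u' (fst z)) * (v (snd z) * v' (snd z)) \<partial>(M1 \<Otimes>\<^sub>M M2))"
    unfolding L2_inner_def by (simp add: mult_ac)
  also have "\<dots> = L2_inner M1 u u' * L2_inner M2 v v'"
    unfolding L2_inner_def using integral_fst'[OF int[OF I]] by simp
  finally show "L2_inner (M1 \<Otimes>\<^sub>M M2) (\<lambda>z. u (fst z) * v (snd z)) (\<lambda>z. u' (fst z) * v' (snd z)) =
    L2_inner M1 u u' * L2_inner M2 v v'" .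
  have [measurable]: "u \<in> borel_measurable M1" "v \<in> borel_measurable M2"
    using u v by (auto intro: L2_measurable)
  show "(\<lambda>z. u (fst z) * v (snd z)) \<in> L2 (M1 \<Otimes>\<^sub>M M2)"
    using int[of "\<lambda>x. (u x)\<^sup>2" "\<lambda>y. (v y)\<^sup>2"] u v by (simp add: L2_def power_mult_distrib)
qed

section \<open>Mixtures of product laws\<close>

lemma L2_densitiesD:
  assumes "f \<in> L2_densities M"
  shows "f \<in> L2 M" "AE z in M. f z \<ge> 0" "(\<integral>z. f z \<partial>M) = 1"
  using assms by (auto simp: L2_densities_def)

lemma nn_integral_mult_densities:
  assumes "f \<in> L2 M" "AE z in M. f z \<ge> 0" "g \<in> L2 M" "AE z in M. g z \<ge> 0"
  shows "(\<integral>\<^sup>+z. ennreal (f z) * ennreal (g z) \<partial>M) = ennreal (L2_inner M f g)"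
proof -
  have "(\<integral>\<^sup>+z. ennreal (f z) * ennreal (g z) \<partial>M) = (\<integral>\<^sup>+z. ennreal (f z * g z) \<partial>M)"
    using assms(2,4) by (intro nn_integral_cong_AE) (auto simp: ennreal_mult)
  also have "\<dots> = ennreal (L2_inner M f g)"
    unfolding L2_inner_def using assms
    by (intro nn_integral_eq_integral L2_integrable_mult) auto
  finally show ?thesis .
qed

lemma (in finite_measure) L2_indicator: "A \<in> sets M \<Longrightarrow> (indicator A :: 'a \<Rightarrow> real) \<in> L2 M"
  by (rule L2_bounded[of _ 1]) (auto simp: indicator_def)

text \<open>On rectangles the \<open>n\<close>-fold power of the law with density \<open>u\<close> is a function of finitely many
  inner products of \<open>u\<close> with indicators. This makes the kernel \<open>u \<mapsto> P\<^sub>u\<^sup>n\<close> accessible through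
  continuous functionals.\<close>

lemma emeasure_power_law_PiE:
  assumes "prob_space M" "u \<in> L2_densities M" "\<And>i. i < n \<Longrightarrow> A i \<in> sets M"
  shows "emeasure (power_law n (density_law M u)) (Pi\<^sub>E {..<n} A) =
    (\<Prod>i<n. ennreal (L2_inner M u (indicator (A i))))"
proof -
  interpret M: prob_space M by fact
  interpret N: prob_space "density_law M u"
    using assms by (intro prob_space_density_law M.finite_measure_axioms)
  interpret PN: product_sigma_finite "\<lambda>_::nat. density_law M u" ..
  note u = L2_densitiesD[OF assms(2)]
  have [measurable]: "u \<in> borel_measurable M" using u(1) by (rule L2_measurable)
  have "emeasure (density_law M u) A = ennreal (L2_inner M u (indicator A))"
    if [measurable]: "A \<in> sets M" for A
  proof -
    have "emeasure (density_law M u) A = (\<integral>\<^sup>+z. ennreal (u z) * ennreal (indicator A z) \<partial>M)"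
      by (simp add: density_law_def emeasure_density ennreal_indicator)
    also have "\<dots> = ennreal (L2_inner M u (indicator A))"
      using u by (intro nn_integral_mult_densities M.L2_indicator) auto
    finally show ?thesis .
  qed
  then show ?thesis
    using assms(3) unfolding power_law_def
    by (subst PN.emeasure_PiM) (auto simp: density_law_def intro!: prod.cong)
qed

text \<open>A random element of \<open>L\<^sup>2\<close> that takes values in the densities yields a probability kernel
  into the \<open>n\<close>-fold product space. Rectangles form an intersection-stable generator, so it
  suffices to look at them.\<close>

lemma measurable_power_law:
  assumes M: "prob_space M" and f: "f \<in> Q \<rightarrow>\<^sub>M L2_borel M"
    and fd: "\<And>v. v \<in> space Q \<Longrightarrow> f v \<in> L2_densities M"
  shows "(\<lambda>v. power_law n (density_law M (f v))) \<in> Q \<rightarrow>\<^sub>M prob_algebra (power_law n M)"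
proof (rule measurable_prob_algebra_generated)
  interpret M: prob_space M by fact
  show "sets (power_law n M) =
      sigma_sets (\<Pi>\<^sub>E i\<in>{..<n}. space M) (prod_algebra {..<n} (\<lambda>_. M))"
    by (simp add: power_law_def sets_PiM)
  show "Int_stable (prod_algebra {..<n} (\<lambda>_. M))" by (rule Int_stable_prod_algebra)
  show "prod_algebra {..<n} (\<lambda>_. M) \<subseteq> Pow (\<Pi>\<^sub>E i\<in>{..<n}. space M)"
    by (rule prod_algebra_sets_into_space)
  show "prob_space (power_law n (density_law M (f v)))" if "v \<in> space Q" for v
    unfolding power_law_def
    by (intro prob_space_PiM prob_space_density_law M.finite_measure_axioms fd that)
  show "sets (power_law n (density_law M (f v))) = sets (power_law n M)" for v
    unfolding power_law_def by (intro sets_PiM_cong) (auto simp: density_law_def)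
  fix A assume "A \<in> prod_algebra {..<n} (\<lambda>_. M)"
  then obtain X where A: "A = Pi\<^sub>E {..<n} X" and X: "\<And>i. i < n \<Longrightarrow> X i \<in> sets M"
    by (auto simp: prod_algebra_eq_finite)
  have "(\<lambda>v. \<Prod>i<n. ennreal (L2_inner M (f v) (indicator (X i)))) \<in> borel_measurable Q"
    using X by (intro borel_measurable_prod_ennreal measurable_compose[OF _ measurable_ennreal]
        measurable_compose[OF f] measurable_L2_inner M.L2_indicator) auto
  then show "(\<lambda>v. emeasure (power_law n (density_law M (f v))) A) \<in> borel_measurable Q"
    by (subst measurable_cong) (auto simp: A emeasure_power_law_PiE M fd X)
qed

locale L2_mixture = Q: prob_space Q + M: prob_space M
  for Q :: "'v measure" and M :: "'z measure" +
  fixes f :: "'v \<Rightarrow> 'z \<Rightarrow> real" and n :: nat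
  assumes f: "f \<in> Q \<rightarrow>\<^sub>M L2_borel M"
    and fd: "\<And>v. v \<in> space Q \<Longrightarrow> f v \<in> L2_densities M"
begin

abbreviation "component v \<equiv> power_law n (density_law M (f v))"

abbreviation "mixture \<equiv> mixture_law Q n M f"

lemma measurable_component_law: "component \<in> Q \<rightarrow>\<^sub>M subprob_algebra (power_law n M)"
  using measurable_power_law[OF M.prob_space_axioms f, of n] fd
  by (intro measurable_prob_algebraD) blast

lemma sets_mixture: "sets mixture = sets (power_law n M)"
  unfolding mixture_law_def by (rule sets_bind_measurable[OF measurable_component_law Q.not_empty])

lemma prob_space_mixture: "prob_space mixture"
  unfolding mixture_law_def
  by (rule Q.prob_space_bind[OF _ measurable_component_law])
     (auto simp: power_law_def intro!: AE_I2 prob_space_PiM prob_space_density_law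
        M.finite_measure_axioms fd)

lemma nn_integral_mixture:
  "h \<in> borel_measurable (power_law n M) \<Longrightarrow>
    (\<integral>\<^sup>+z. h z \<partial>mixture) = (\<integral>\<^sup>+v. (\<integral>\<^sup>+z. h z \<partial>component v) \<partial>Q)"
  unfolding mixture_law_def by (rule nn_integral_bind[OF _ measurable_component_law])

lemma component_eq_density:
  "v \<in> space Q \<Longrightarrow> component v = density (power_law n M) (\<lambda>z. \<Prod>i<n. ennreal (f v (z i)))"
  by (intro power_law_density_law M.prob_space_axioms fd)

lemma measurable_likelihood:
  assumes "v \<in> space Q"
  shows "(\<lambda>z. \<Prod>i<n. ennreal (f v (z i))) \<in> borel_measurable (power_law n M)"
proof -
  have [measurable]: "f v \<in> borel_measurable M"
    using fd[OF assms] by (auto dest: L2_densitiesD L2_measurable)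
  show ?thesis unfolding power_law_def by measurable
qed

text \<open>The right-hand side sees \<open>f\<close> only through its distribution on \<open>L\<^sup>2\<close>.\<close>

lemma emeasure_mixture_PiE:
  assumes "\<And>i. i < n \<Longrightarrow> A i \<in> sets M"
  shows "emeasure mixture (Pi\<^sub>E {..<n} A) =
    (\<integral>\<^sup>+u. (\<Prod>i<n. ennreal (L2_inner M u (indicator (A i)))) \<partial>distr Q (L2_borel M) f)"
proof -
  have "Pi\<^sub>E {..<n} A \<in> sets (power_law n M)"
    unfolding power_law_def using assms by (intro sets_PiM_I_finite) auto
  then have "emeasure mixture (Pi\<^sub>E {..<n} A) = (\<integral>\<^sup>+v. emeasure (component v) (Pi\<^sub>E {..<n} A) \<partial>Q)"
    unfolding mixture_law_def by (rule emeasure_bind[OF Q.not_empty measurable_component_law])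
  also have "\<dots> = (\<integral>\<^sup>+v. (\<Prod>i<n. ennreal (L2_inner M (f v) (indicator (A i)))) \<partial>Q)"
    by (intro nn_integral_cong emeasure_power_law_PiE M.prob_space_axioms fd assms)
  also have "\<dots> = (\<integral>\<^sup>+u. (\<Prod>i<n. ennreal (L2_inner M u (indicator (A i)))) \<partial>distr Q (L2_borel M) f)"
    using assms by (subst nn_integral_distr[OF f])
      (auto intro!: borel_measurable_prod_ennreal measurable_compose[OF _ measurable_ennreal]
        measurable_L2_inner M.L2_indicator)
  finally show ?thesis .
qed

text \<open>The second moment of the likelihood ratio of the mixture, as a double average of inner
  products. Write \<open>F\<^sub>v = \<Prod> f\<^sub>v(z\<^sub>i)\<close> for the density of the component \<open>K\<^sub>v\<close> and \<open>\<nu>\<close> for the mixture.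
  Since \<open>\<integral> g\<^sup>2 dR = \<integral> g d\<nu>\<close> is the average over \<open>v\<close> of
  \<open>\<integral> g dK\<^sub>v = \<integral> F\<^sub>v g dR = \<integral> F\<^sub>v d\<nu>\<close>, and the last integral is an average over a second copy \<open>u\<close>
  of \<open>\<integral> F\<^sub>v dK\<^sub>u = \<integral> F\<^sub>v F\<^sub>u dR\<close>, one arrives at products that factorise over the coordinates.
  Fubini's theorem, which would ask for joint measurability of \<open>f\<close>, is avoided.\<close>

lemma mixture_density:
  obtains g where "g \<in> borel_measurable (power_law n M)" "mixture = density (power_law n M) g"
    "(\<integral>\<^sup>+z. g z * g z \<partial>power_law n M) =
       (\<integral>\<^sup>+v. (\<integral>\<^sup>+v'. ennreal (L2_inner M (f v) (f v')) ^ n \<partial>Q) \<partial>Q)"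
proof -
  let ?R = "power_law n M"
  let ?F = "\<lambda>v z. \<Prod>i<n. ennreal (f v (z i))"
  interpret R: prob_space ?R
    unfolding power_law_def by (intro prob_space_PiM M.prob_space_axioms)
  interpret PM: product_sigma_finite "\<lambda>_::nat. M" ..
  have "absolutely_continuous ?R mixture"
    unfolding absolutely_continuous_def
  proof
    fix A assume A: "A \<in> null_sets ?R"
    have "emeasure mixture A = (\<integral>\<^sup>+v. emeasure (component v) A \<partial>Q)"
      unfolding mixture_law_def using A
      by (intro emeasure_bind[OF Q.not_empty measurable_component_law]) auto
    also have "\<dots> = (\<integral>\<^sup>+v. 0 \<partial>Q)"
    proof (rule nn_integral_cong)
      fix v assume v: "v \<in> space Q"
      show "emeasure (component v) A = 0"
        unfolding component_eq_density[OF v]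
        using A absolutely_continuousI_density[OF measurable_likelihood[OF v]]
        by (auto simp: absolutely_continuous_def)
    qed
    finally show "A \<in> null_sets mixture"
      using A by (intro null_setsI) (simp_all add: sets_mixture null_setsD2)
  qed
  with R.Radon_Nikodym[OF _ sets_mixture] obtain g
    where g: "g \<in> borel_measurable ?R" and eq: "density ?R g = mixture" by auto
  have inner: "(\<integral>\<^sup>+z. g z \<partial>component v) = (\<integral>\<^sup>+v'. ennreal (L2_inner M (f v) (f v')) ^ n \<partial>Q)"
    if v: "v \<in> space Q" for v
  proof -
    have "(\<integral>\<^sup>+z. g z \<partial>component v) = (\<integral>\<^sup>+z. ?F v z * g z \<partial>?R)"
      unfolding component_eq_density[OF v] by (rule nn_integral_density[OF measurable_likelihood[OF v] g])
    also have "\<dots> = (\<integral>\<^sup>+z. ?F v z \<partial>mixture)"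
      unfolding eq[symmetric] nn_integral_density[OF g measurable_likelihood[OF v]]
      by (simp add: mult.commute)
    also have "\<dots> = (\<integral>\<^sup>+v'. (\<integral>\<^sup>+z. ?F v z \<partial>component v') \<partial>Q)"
      by (rule nn_integral_mixture[OF measurable_likelihood[OF v]])
    also have "\<dots> = (\<integral>\<^sup>+v'. ennreal (L2_inner M (f v) (f v')) ^ n \<partial>Q)"
    proof (rule nn_integral_cong)
      fix v' assume v': "v' \<in> space Q"
      note u = L2_densitiesD[OF fd[OF v]] and u' = L2_densitiesD[OF fd[OF v']]
      have [measurable]: "f v \<in> borel_measurable M" "f v' \<in> borel_measurable M"
        using u u' by (auto intro: L2_measurable)
      have "(\<integral>\<^sup>+z. ?F v z \<partial>component v') = (\<integral>\<^sup>+z. ?F v' z * ?F v z \<partial>?R)"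
        unfolding component_eq_density[OF v']
        by (rule nn_integral_density[OF measurable_likelihood[OF v'] measurable_likelihood[OF v]])
      also have "\<dots> = (\<integral>\<^sup>+z. (\<Prod>i<n. ennreal (f v (z i)) * ennreal (f v' (z i))) \<partial>PiM {..<n} (\<lambda>_. M))"
        by (simp add: power_law_def prod.distrib mult.commute)
      also have "\<dots> = (\<Prod>i<n. \<integral>\<^sup>+x. ennreal (f v x) * ennreal (f v' x) \<partial>M)"
        by (rule PM.product_nn_integral_prod) auto
      also have "\<dots> = ennreal (L2_inner M (f v) (f v')) ^ n"
        using u u' by (simp add: nn_integral_mult_densities)
      finally show "(\<integral>\<^sup>+z. ?F v z \<partial>component v') = ennreal (L2_inner M (f v) (f v')) ^ n" .
    qed
    finally show ?thesis .
  qed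
  have "(\<integral>\<^sup>+z. g z * g z \<partial>?R) = (\<integral>\<^sup>+z. g z \<partial>mixture)"
    unfolding eq[symmetric] nn_integral_density[OF g g] ..
  also have "\<dots> = (\<integral>\<^sup>+v. (\<integral>\<^sup>+z. g z \<partial>component v) \<partial>Q)"
    by (rule nn_integral_mixture[OF g])
  also have "\<dots> = (\<integral>\<^sup>+v. (\<integral>\<^sup>+v'. ennreal (L2_inner M (f v) (f v')) ^ n \<partial>Q) \<partial>Q)"
    by (intro nn_integral_cong inner)
  finally show thesis using that[OF g eq[symmetric]] by blast
qed

end

text \<open>A random density enters the mixture only through its distribution, because two finite
  measures that agree on rectangles are equal.\<close>

lemma mixture_law_cong_distr:
  assumes "L2_mixture Q M f" "L2_mixture Q' M f'"
    and "distr Q (L2_borel M) f = distr Q' (L2_borel M) f'"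
  shows "mixture_law Q n M f = mixture_law Q' n M f'"
proof -
  interpret A: L2_mixture Q M f n by fact
  interpret B: L2_mixture Q' M f' n by fact
  interpret prob_space "mixture_law Q n M f" by (rule A.prob_space_mixture)
  show ?thesis
  proof (rule measure_eqI_PiM_finite[of "{..<n}" _ "\<lambda>_. M"])
    show "sets (mixture_law Q n M f) = sets (PiM {..<n} (\<lambda>_. M))"
      "sets (mixture_law Q' n M f') = sets (PiM {..<n} (\<lambda>_. M))"
      using A.sets_mixture B.sets_mixture by (simp_all add: power_law_def)
    show "emeasure (mixture_law Q n M f) (Pi\<^sub>E {..<n} A) = emeasure (mixture_law Q' n M f') (Pi\<^sub>E {..<n} A)"
      if "\<And>i. i \<in> {..<n} \<Longrightarrow> A i \<in> sets M" for A
      using that by (simp add: A.emeasure_mixture_PiE B.emeasure_mixture_PiE assms(3))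
    show "range (\<lambda>_::nat. \<Pi>\<^sub>E i\<in>{..<n}. space M) \<subseteq> prod_algebra {..<n} (\<lambda>_. M)"
      by (auto simp: prod_algebra_eq_finite)
  qed (auto simp: space_PiM)
qed

section \<open>Total variation and the second moment\<close>

text \<open>The bound by the chi-square divergence, with the optimal constant \<open>1/4\<close>. Since \<open>g - 1\<close> has
  integral zero, \<open>1\<^sub>C\<close> may be replaced by \<open>1\<^sub>C - 1/2\<close>, whose absolute value is \<open>1/2\<close> everywhere.\<close>

lemma tv_dist_le_second_moment:
  assumes R: "prob_space R" and g[measurable]: "g \<in> borel_measurable R"
    and N: "prob_space (density R g)"
    and B: "(\<integral>\<^sup>+z. g z * g z \<partial>R) \<le> ennreal B" "0 \<le> B"
  shows "(tv_dist R (density R g))\<^sup>2 \<le> (B - 1) / 4"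
proof -
  interpret R: prob_space R by fact
  interpret N: prob_space "density R g" by fact
  define h where "h z = enn2real (g z)" for z
  have [measurable]: "h \<in> borel_measurable R" unfolding h_def by measurable
  have h0: "0 \<le> h z" for z by (simp add: h_def)
  have g1: "(\<integral>\<^sup>+z. g z \<partial>R) = 1"
    using N.emeasure_space_1 by (simp add: emeasure_density cong: nn_integral_cong)
  have gh: "AE z in R. g z = ennreal (h z)"
    using nn_integral_PInf_AE[OF g] g1 by (auto simp: h_def less_top[symmetric])
  have sq: "(\<integral>\<^sup>+z. ennreal ((h z)\<^sup>2) \<partial>R) = (\<integral>\<^sup>+z. g z * g z \<partial>R)"
    using gh by (intro nn_integral_cong_AE) (auto simp: ennreal_mult h0 power2_eq_square)
  have hint: "integrable R (\<lambda>z. (h z)\<^sup>2)"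
    using B(1) by (intro integrableI_nonneg) (auto simp: sq intro: le_less_trans)
  then have hL2: "h \<in> L2 R" by (simp add: L2_def)
  then have hi: "integrable R h" by (rule R.L2_integrable)
  have hB: "(\<integral>z. (h z)\<^sup>2 \<partial>R) \<le> B"
    using B nn_integral_eq_integral[OF hint] by (simp add: sq)
  have meas: "measure (density R g) C = (\<integral>z. h z * indicator C z \<partial>R)" if C[measurable]: "C \<in> sets R" for C
  proof -
    have "emeasure (density R g) C = (\<integral>\<^sup>+z. g z * indicator C z \<partial>R)"
      by (simp add: emeasure_density)
    also have "\<dots> = (\<integral>\<^sup>+z. ennreal (h z * indicator C z) \<partial>R)"
      using gh by (intro nn_integral_cong_AE) (auto simp: indicator_def)
    also have "\<dots> = ennreal (\<integral>z. h z * indicator C z \<partial>R)"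
      using h0 hi by (intro nn_integral_eq_integral integrable_real_mult_indicator) auto
    finally show ?thesis
      using h0 by (simp add: measure_def enn2real_ennreal integral_nonneg_AE)
  qed
  have h1: "(\<integral>z. h z \<partial>R) = 1"
    using meas[of "space R"] N.prob_space by (simp cong: Bochner_Integration.integral_cong)
  have d2: "L2_inner R (\<lambda>z. h z - 1) (\<lambda>z. h z - 1) = (\<integral>z. (h z)\<^sup>2 \<partial>R) - 1"
  proof -
    have "L2_inner R (\<lambda>z. h z - 1) (\<lambda>z. h z - 1) = (\<integral>z. (h z)\<^sup>2 - 2 * h z + 1 \<partial>R)"
      unfolding L2_inner_def by (simp add: power2_eq_square algebra_simps)
    then show ?thesis using hint hi by (simp add: h1 R.prob_space)
  qed
  have c1: "(\<lambda>_. 1) \<in> L2 R" by (rule R.L2_bounded[of _ 1]) auto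
  have bound: "\<bar>measure R C - measure (density R g) C\<bar> \<le> sqrt ((B - 1) / 4)" if C[measurable]: "C \<in> sets R" for C
  proof -
    let ?s = "\<lambda>z. indicator C z - 1 / 2 :: real"
    have s: "?s \<in> L2 R" by (rule R.L2_bounded[of _ 1]) (auto simp: indicator_def)
    have ss: "L2_inner R ?s ?s = 1 / 4"
    proof -
      have "?s z * ?s z = 1 / 4" for z by (simp add: indicator_def)
      then show ?thesis unfolding L2_inner_def by (simp only: R.prob_space lebesgue_integral_const) simp
    qed
    have "measure (density R g) C - measure R C = (\<integral>z. (h z * indicator C z - indicator C z) - (h z - 1) / 2 \<partial>R)"
      using hi integrable_real_mult_indicator[OF C hi]
      by (simp add: meas[OF C] h1 R.prob_space R.emeasure_eq_measure)
    also have "\<dots> = L2_inner R (\<lambda>z. h z - 1) ?s"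
      unfolding L2_inner_def by (intro Bochner_Integration.integral_cong) (auto simp: algebra_simps diff_divide_distrib)
    finally have "\<bar>measure R C - measure (density R g) C\<bar> \<le> L2_seminorm R (\<lambda>z. h z - 1) * L2_seminorm R ?s"
      using L2_Cauchy_Schwarz[OF L2_diff[OF hL2 c1] s] by (simp add: abs_minus_commute)
    also have "\<dots> = sqrt (((\<integral>z. (h z)\<^sup>2 \<partial>R) - 1) / 4)"
      unfolding L2_seminorm_def ss d2 by (simp add: real_sqrt_divide real_sqrt_mult[symmetric])
    also have "\<dots> \<le> sqrt ((B - 1) / 4)" using hB by simp
    finally show ?thesis .
  qed
  have "0 \<le> (B - 1) / 4"
    using hB d2 L2_inner_self_nonneg[of R "\<lambda>z. h z - 1"] by simp
  moreover have "tv_dist R (density R g) \<le> sqrt ((B - 1) / 4)"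
    unfolding tv_dist_def by (rule cSUP_least) (auto intro: bound)
  moreover have "0 \<le> tv_dist R (density R g)"
    unfolding tv_dist_def using bound
    by (intro cSUP_upper2[of _ _ "{}"] bdd_aboveI2[where M = "sqrt ((B - 1) / 4)"]) auto
  ultimately show ?thesis
    using power_mono[of "tv_dist R (density R g)" "sqrt ((B - 1) / 4)" 2] by simp
qed

section \<open>Rademacher series\<close>

lemma rademacher_AE:
  assumes "prob_space P" "rademacher P X"
  shows "AE w in P. X w = 1 \<or> X w = - 1"
proof -
  interpret prob_space P by fact
  have [measurable]: "X \<in> borel_measurable P"
    and half: "prob {w \<in> space P. X w = 1} = 1/2" "prob {w \<in> space P. X w = - 1} = 1/2"
    using assms(2) by (auto simp: rademacher_def)
  have "prob ({w \<in> space P. X w = 1} \<union> {w \<in> space P. X w = - 1}) = 1"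
    by (subst finite_measure_Union) (auto simp: half)
  then have "AE w in P. w \<in> {w \<in> space P. X w = 1} \<union> {w \<in> space P. X w = - 1}"
    by (intro AE_prob_1)
  then show ?thesis by (rule eventually_mono) auto
qed

text \<open>This is Hoeffding's lemma on the interval \<open>[-1, 1]\<close> for a centred variable. That lemma is
  about positive multiples; negative ones are covered by the symmetry of the law.\<close>

lemma rademacher_subgaussian:
  assumes "prob_space P" "rademacher P X"
  shows "(\<integral>\<^sup>+w. ennreal (exp (l * X w)) \<partial>P) \<le> ennreal (exp (l\<^sup>2 / 2))"
proof -
  interpret prob_space P by fact
  have pos: "(\<integral>\<^sup>+w. ennreal (exp (t * Y w)) \<partial>P) \<le> ennreal (exp (t\<^sup>2 / 2))"
    if Y: "rademacher P Y" and t: "t > 0" for Y t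
  proof -
    have [measurable]: "Y \<in> borel_measurable P"
      and half: "prob {w \<in> space P. Y w = 1} = 1/2" "prob {w \<in> space P. Y w = - 1} = 1/2"
      using Y by (auto simp: rademacher_def)
    interpret interval_bounded_random_variable P Y "-1" 1
      by standard (use rademacher_AE[OF \<open>prob_space P\<close> Y] in auto)
    have "expectation Y = (\<integral>w. indicator {w \<in> space P. Y w = 1} w - indicator {w \<in> space P. Y w = - 1} w \<partial>P)"
      using rademacher_AE[OF \<open>prob_space P\<close> Y]
      by (intro integral_cong_AE) (auto simp: indicator_def)
    also have "\<dots> = 0"
      by (subst Bochner_Integration.integral_diff)
        (auto simp: half less_top[symmetric] intro!: integrable_real_indicator)
    finally show ?thesis using Hoeffdings_lemma_nn_integral_0[OF t] by simp
  qed
  have "(- x = 1) = (x = - 1)" "(- x = - 1) = (x = 1)" for x :: real by auto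
  then have "rademacher P (\<lambda>w. - X w)"
    using assms(2) by (simp add: rademacher_def)
  then have neg: "(\<integral>\<^sup>+w. ennreal (exp (l * X w)) \<partial>P) \<le> ennreal (exp (l\<^sup>2 / 2))" if "l < 0"
    using pos[of "\<lambda>w. - X w" "- l"] that by simp
  consider "l < 0" | "l = 0" | "l > 0" by linarith
  then show ?thesis
    using neg pos[OF assms(2)] by cases (simp_all add: emeasure_space_1)
qed

lemma rademacher_sum_subgaussian:
  assumes "prob_space P" and S: "finite S"
    and rad: "\<And>i. i \<in> S \<Longrightarrow> rademacher P (X i)"
    and indep: "prob_space.indep_vars P (\<lambda>_. borel) X S"
  shows "(\<integral>\<^sup>+w. ennreal (exp (\<Sum>i\<in>S. c i * X i w)) \<partial>P) \<le> ennreal (exp ((\<Sum>i\<in>S. (c i)\<^sup>2) / 2))"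
proof -
  interpret prob_space P by fact
  have "(\<integral>\<^sup>+w. ennreal (exp (\<Sum>i\<in>S. c i * X i w)) \<partial>P) = (\<integral>\<^sup>+w. (\<Prod>i\<in>S. ennreal (exp (c i * X i w))) \<partial>P)"
    using S by (simp add: exp_sum prod_ennreal)
  also have "\<dots> = (\<Prod>i\<in>S. \<integral>\<^sup>+w. ennreal (exp (c i * X i w)) \<partial>P)"
    using S indep
    by (intro indep_vars_nn_integral indep_vars_compose2[OF indep, of "\<lambda>i x. ennreal (exp (c i * x))"]) auto
  also have "\<dots> \<le> (\<Prod>i\<in>S. ennreal (exp ((c i)\<^sup>2 / 2)))"
    by (intro prod_mono_ennreal rademacher_subgaussian assms rad)
  also have "\<dots> = ennreal (exp ((\<Sum>i\<in>S. (c i)\<^sup>2) / 2))"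
    using S by (simp add: prod_ennreal exp_sum[symmetric] sum_divide_distrib)
  finally show ?thesis .
qed

text \<open>Convergence along the net of finite subsets of a countable set implies convergence along a
  sequence of finite subsets, which is what Fatou's lemma asks for.\<close>

lemma countable_exhaustion:
  assumes "countable I"
  obtains S :: "nat \<Rightarrow> 'i set" where "\<And>m. finite (S m)" "\<And>m. S m \<subseteq> I"
    "filterlim S (finite_subsets_at_top I) sequentially"
proof
  let ?S = "\<lambda>m. {i \<in> I. to_nat_on I i < m}"
  show fin: "finite (?S m)" for m
    by (rule inj_on_finite[OF inj_on_subset[OF inj_on_to_nat_on[OF assms]], of _ "{..<m}"]) auto
  show sub: "?S m \<subseteq> I" for m by auto
  show "filterlim ?S (finite_subsets_at_top I) sequentially"
    unfolding filterlim_finite_subsets_at_top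
  proof (intro allI impI)
    fix X assume X: "finite X \<and> X \<subseteq> I"
    have "X \<subseteq> ?S m" if "m \<ge> Suc (Max (to_nat_on I ` X))" for m
    proof
      fix i assume i: "i \<in> X"
      then have "to_nat_on I i \<le> Max (to_nat_on I ` X)" using X by (intro Max_ge) auto
      then have "to_nat_on I i < m" using that by linarith
      then show "i \<in> ?S m" using i X by auto
    qed
    then show "\<forall>\<^sub>F m in sequentially. finite (?S m) \<and> X \<subseteq> ?S m \<and> ?S m \<subseteq> I"
      using fin sub unfolding eventually_sequentially by blast
  qed
qed

text \<open>Fatou's lemma carries the bound for finite sums over to the series. The limit \<open>Y\<close> is
  almost everywhere a lower limit of partial sums along an exhausting sequence of index sets.\<close>

lemma rademacher_series_subgaussian:
  assumes "prob_space P" and I: "countable I"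
    and rad: "\<And>i. i \<in> I \<Longrightarrow> rademacher P (X i)"
    and indep: "prob_space.indep_vars P (\<lambda>_. borel) X I"
    and Y: "AE w in P. ((\<lambda>i. c i * X i w) has_sum Y w) I"
    and c: "(\<lambda>i. (c i)\<^sup>2) summable_on I"
  shows "(\<integral>\<^sup>+w. ennreal (exp (Y w)) \<partial>P) \<le> ennreal (exp ((\<Sum>\<^sub>\<infinity>i\<in>I. (c i)\<^sup>2) / 2))"
proof -
  interpret prob_space P by fact
  obtain S where S: "\<And>m. finite (S m)" "\<And>m. S m \<subseteq> I"
    and lim: "filterlim S (finite_subsets_at_top I) sequentially"
    using countable_exhaustion[OF I] by blast
  let ?u = "\<lambda>m w. ennreal (exp (\<Sum>i\<in>S m. c i * X i w))"
  have [measurable]: "X i \<in> borel_measurable P" if "i \<in> S m" for i m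
    using rad that S by (auto simp: rademacher_def)
  have "(\<integral>\<^sup>+w. ennreal (exp (Y w)) \<partial>P) = (\<integral>\<^sup>+w. liminf (\<lambda>m. ?u m w) \<partial>P)"
  proof (rule nn_integral_cong_AE)
    show "AE w in P. ennreal (exp (Y w)) = liminf (\<lambda>m. ?u m w)"
      using Y
    proof eventually_elim
      case (elim w)
      then have "(\<lambda>m. \<Sum>i\<in>S m. c i * X i w) \<longlonglongrightarrow> Y w"
        unfolding has_sum_def by (rule filterlim_compose[OF _ lim])
      then have "(\<lambda>m. ?u m w) \<longlonglongrightarrow> ennreal (exp (Y w))"
        by (intro tendsto_ennrealI tendsto_exp)
      then show ?case by (rule lim_imp_Liminf[OF sequentially_bot, symmetric])
    qed
  qed
  also have "\<dots> \<le> liminf (\<lambda>m. \<integral>\<^sup>+w. ?u m w \<partial>P)"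
    by (rule nn_integral_liminf) measurable
  also have "\<dots> \<le> ennreal (exp ((\<Sum>\<^sub>\<infinity>i\<in>I. (c i)\<^sup>2) / 2))"
  proof (rule Liminf_le)
    show "\<forall>\<^sub>F m in sequentially. (\<integral>\<^sup>+w. ?u m w \<partial>P) \<le> ennreal (exp ((\<Sum>\<^sub>\<infinity>i\<in>I. (c i)\<^sup>2) / 2))"
    proof (rule always_eventually, rule allI)
      fix m
      have "(\<integral>\<^sup>+w. ?u m w \<partial>P) \<le> ennreal (exp ((\<Sum>i\<in>S m. (c i)\<^sup>2) / 2))"
        using S rad by (intro rademacher_sum_subgaussian assms indep_vars_subset[OF indep]) auto
      also have "(\<Sum>i\<in>S m. (c i)\<^sup>2) \<le> (\<Sum>\<^sub>\<infinity>i\<in>I. (c i)\<^sup>2)"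
        using S by (intro finite_sum_le_infsum c) auto
      then have "ennreal (exp ((\<Sum>i\<in>S m. (c i)\<^sup>2) / 2)) \<le> ennreal (exp ((\<Sum>\<^sub>\<infinity>i\<in>I. (c i)\<^sup>2) / 2))"
        by (intro ennreal_leI) simp
      finally show "(\<integral>\<^sup>+w. ?u m w \<partial>P) \<le> ennreal (exp ((\<Sum>\<^sub>\<infinity>i\<in>I. (c i)\<^sup>2) / 2))" .
    qed
  qed simp
  finally show ?thesis .
qed

text \<open>A square-summable family is bounded, and this dominates its fourth powers by a multiple of its
  squares. Without summability the infinite sum in the exponent would be \<open>0\<close> by
  convention and the bounds on the partial sums would be lost.\<close>

lemma summable_on_power4:
  fixes a :: "'i \<Rightarrow> real"
  assumes "(\<lambda>i. (a i)\<^sup>2) summable_on I"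
  shows "(\<lambda>i. (a i) ^ 4) summable_on I"
proof (rule summable_on_comparison_test)
  let ?T = "\<Sum>\<^sub>\<infinity>i\<in>I. (a i)\<^sup>2"
  show "(\<lambda>i. ?T * (a i)\<^sup>2) summable_on I" by (intro summable_on_cmult_right assms)
  fix i assume "i \<in> I"
  then have "(a i)\<^sup>2 \<le> ?T" using finite_sum_le_infsum[OF assms, of "{i}"] by simp
  then have "(a i)\<^sup>2 * (a i)\<^sup>2 \<le> ?T * (a i)\<^sup>2" by (intro mult_right_mono) auto
  then show "(a i) ^ 4 \<le> ?T * (a i)\<^sup>2" by (simp add: power_add[symmetric])
qed simp

section \<open>Random sign perturbations of the uniform density\<close>

text \<open>The bound for an arbitrary countable orthonormal system in \<open>L\<^sup>2\<close> of a probability space,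
  perturbing the uniform density. The power of \<open>P(E)\<close> is \<open>1\<close>: the exponential moment over one copy
  of the signs is bounded uniformly in the other copy, so that only one of the two
  conditional expectations is compared with an unconditional one.\<close>

lemma rademacher_mixture_tv_bound:
  fixes M :: "'z measure" and e :: "'i \<Rightarrow> 'z \<Rightarrow> real" and a :: "'i \<Rightarrow> real"
    and P :: "'w measure" and X :: "'i \<Rightarrow> 'w \<Rightarrow> real" and p :: "'w \<Rightarrow> 'z \<Rightarrow> real"
    and Q :: "'v measure" and f :: "'v \<Rightarrow> 'z \<Rightarrow> real"
  defines "E \<equiv> {w \<in> space P. p w \<in> L2_densities M}"
  assumes M: "prob_space M" and I: "countable I"
    and e: "\<And>i. i \<in> I \<Longrightarrow> e i \<in> L2 M"
    and on: "\<And>i j. i \<in> I \<Longrightarrow> j \<in> I \<Longrightarrow> L2_inner M (e i) (e j) = (if i = j then 1 else 0)"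
    and e0: "e0 \<in> borel_measurable M" "\<And>z. z \<in> space M \<Longrightarrow> e0 z = 1"
    and a: "(\<lambda>i. (a i)\<^sup>2) summable_on I"
    and P: "prob_space P"
    and rad: "\<And>i. i \<in> I \<Longrightarrow> rademacher P (X i)"
    and indep: "prob_space.indep_vars P (\<lambda>_. borel) X I"
    and p: "p \<in> P \<rightarrow>\<^sub>M L2_borel M"
    and series: "AE w in P. has_L2_sum M (\<lambda>i z. (a i * X i w) * e i z) I (\<lambda>z. p w z - e0 z)"
    and E: "E \<in> sets P" "measure P E > 0"
    and Qf: "L2_mixture Q M f"
    and law: "distr Q (L2_borel M) f = distr (uniform_measure P E) (L2_borel M) p"
  shows "(tv_dist (power_law n M) (mixture_law Q n M f))\<^sup>2
    \<le> (exp ((real n)\<^sup>2 / 2 * (\<Sum>\<^sub>\<infinity>i\<in>I. (a i) ^ 4)) / measure P E - 1) / 4"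
proof -
  interpret M: prob_space M by fact
  interpret P: prob_space P by fact
  let ?V = "(real n)\<^sup>2 / 2 * (\<Sum>\<^sub>\<infinity>i\<in>I. (a i) ^ 4)"
  let ?B = "exp ?V / measure P E"
  \<comment> \<open>The complement of \<open>E\<close> is a null set for the conditional probability. There \<open>p\<close> is
    replaced by the uniform density, so that every value of the random element is a density.\<close>
  define Q' where "Q' = uniform_measure P E"
  define f' where "f' w = (if w \<in> E then p w else e0)" for w
  have Pe: "emeasure P E = ennreal (measure P E)" by (rule P.emeasure_eq_measure)
  have one: "integral\<^sup>L M (\<lambda>z. h z * e0 z) = integral\<^sup>L M h" for h
    by (rule Bochner_Integration.integral_cong) (auto simp: e0)
  have e0L2: "e0 \<in> L2 M"
    using e0 by (auto simp: L2_def cong: Bochner_Integration.integrable_cong)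
  have e0d: "e0 \<in> L2_densities M"
    using e0L2 e0 M.prob_space
    by (auto simp: L2_densities_def cong: Bochner_Integration.integral_cong)
  have f'd: "f' w \<in> L2_densities M" for w
    using e0d by (auto simp: f'_def E_def)
  have f'P: "f' \<in> P \<rightarrow>\<^sub>M L2_borel M"
    unfolding f'_def using e0L2 E by (intro measurable_If_set p measurable_const) (auto simp: space_L2_borel)
  have setsQ': "sets Q' = sets P" by (simp add: Q'_def)
  have f'Q: "f' \<in> Q' \<rightarrow>\<^sub>M L2_borel M" "p \<in> Q' \<rightarrow>\<^sub>M L2_borel M"
    using f'P p by (simp_all add: measurable_cong_sets[OF setsQ' refl])
  have Q': "prob_space Q'"
    unfolding Q'_def using E by (intro prob_space_uniform_measure) (auto simp: Pe)
  interpret L2_mixture Q' M f' n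
    by (intro L2_mixture.intro L2_mixture_axioms.intro Q' M f'Q f'd)
  have "distr Q' (L2_borel M) p = distr Q' (L2_borel M) f'"
  proof (rule distr_cong_AE[OF refl refl _ f'Q(2,1)])
    show "AE w in Q'. p w = f' w"
      unfolding Q'_def by (rule AE_uniform_measureI[OF E(1)]) (simp add: f'_def)
  qed
  then have mix: "mixture_law Q n M f = mixture"
    using law Qf by (intro mixture_law_cong_distr L2_mixture_axioms) (auto simp: Q'_def)
  define good where "good w \<longleftrightarrow> (\<forall>i\<in>I. X i w = 1 \<or> X i w = - 1) \<and>
    has_L2_sum M (\<lambda>i z. (a i * X i w) * e i z) I (\<lambda>z. p w z - e0 z)" for w
  have "AE w in P. \<forall>i\<in>I. X i w = 1 \<or> X i w = - 1"
    by (intro AE_ball_countable' rademacher_AE P rad I)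
  with series have good: "AE w in P. good w"
    unfolding good_def by eventually_elim blast
  \<comment> \<open>The cross terms are \<open>\<langle>p w, e0\<rangle>\<close>, the integral of the density \<open>p w\<close>. So they are equal
    to \<open>1\<close>.\<close>
  have expand: "L2_inner M (p w) (p w') =
      1 + L2_inner M (\<lambda>z. p w z - e0 z) (\<lambda>z. p w' z - e0 z)" if "w \<in> E" "w' \<in> E" for w w'
  proof -
    have d: "p w \<in> L2_densities M" "p w' \<in> L2_densities M" using that by (auto simp: E_def)
    note L = L2_densitiesD(1)[OF d(1)] L2_densitiesD(1)[OF d(2)] e0L2
    have "L2_inner M h e0 = 1" "L2_inner M e0 h = 1" if "h \<in> L2_densities M" for h
      using that unfolding L2_inner_commute[of M e0 h] unfolding L2_inner_def one
      by (auto dest: L2_densitiesD)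
    from this[OF d(1)] this[OF d(2)] this[OF e0d] show ?thesis
      using L by (simp add: L2_inner_diff_left L2_inner_diff_right L2_diff)
  qed
  have a4: "(\<lambda>i. (a i) ^ 4) summable_on I" by (rule summable_on_power4[OF a])
  have inner: "(\<integral>\<^sup>+w'. ennreal (L2_inner M (f' w) (f' w')) ^ n \<partial>Q') \<le> ennreal ?B"
    if w: "w \<in> E" "good w" for w
  proof -
    let ?c = "\<lambda>i. real n * (a i * X i w * a i)"
    let ?Y = "\<lambda>w'. real n * L2_inner M (\<lambda>z. p w z - e0 z) (\<lambda>z. p w' z - e0 z)"
    \<comment> \<open>The signs of the first copy disappear in the squares, which makes the bound uniform
      in \<open>w\<close>.\<close>
    have sq: "(?c i)\<^sup>2 = (real n)\<^sup>2 * (a i) ^ 4" if "i \<in> I" for i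
    proof -
      have "(X i w)\<^sup>2 = 1" using w(2) that by (auto simp: good_def)
      then show ?thesis by (simp add: power_mult_distrib power_add[symmetric])
    qed
    have "(\<integral>\<^sup>+w'. ennreal (exp (?Y w')) \<partial>P) \<le> ennreal (exp ((\<Sum>\<^sub>\<infinity>i\<in>I. (?c i)\<^sup>2) / 2))"
    proof (rule rademacher_series_subgaussian[OF P I rad indep])
      show "AE w' in P. ((\<lambda>i. ?c i * X i w') has_sum ?Y w') I"
        using good
      proof eventually_elim
        case (elim w')
        have "((\<lambda>i. (a i * X i w) * (a i * X i w')) has_sum
            L2_inner M (\<lambda>z. p w z - e0 z) (\<lambda>z. p w' z - e0 z)) I"
          using w(2) elim by (intro has_sum_L2_inner[OF e on]) (auto simp: good_def)
        from has_sum_cmult_right[OF this, of "real n"] show ?case by (simp add: mult_ac)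
      qed
      show "(\<lambda>i. (?c i)\<^sup>2) summable_on I"
        using summable_on_cmult_right[OF a4, of "(real n)\<^sup>2"] by (simp add: sq cong: summable_on_cong)
    qed
    also have "(\<Sum>\<^sub>\<infinity>i\<in>I. (?c i)\<^sup>2) / 2 = ?V"
      by (simp add: sq infsum_cmult_right' cong: infsum_cong)
    finally have expY: "(\<integral>\<^sup>+w'. ennreal (exp (?Y w')) \<partial>P) \<le> ennreal (exp ?V)" .
    \<comment> \<open>The inner product \<open>\<langle>p w, p w'\<rangle>\<close> is nonnegative because both outcomes lie in \<open>E\<close>, so the
      inequality \<open>1 + x \<le> exp x\<close> can be raised to the \<open>n\<close>-th power.\<close>
    have le: "ennreal (L2_inner M (f' w) (f' w')) ^ n * indicator E w' \<le> ennreal (exp (?Y w'))" for w'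
    proof (cases "w' \<in> E")
      case True
      have "0 \<le> L2_inner M (p w) (p w')"
        using w(1) True unfolding L2_inner_def
        by (intro integral_nonneg_AE) (auto simp: E_def L2_densities_def)
      moreover have "L2_inner M (p w) (p w') \<le>
          exp (L2_inner M (\<lambda>z. p w z - e0 z) (\<lambda>z. p w' z - e0 z))"
        unfolding expand[OF w(1) True] by (rule exp_ge_add_one_self)
      ultimately have "L2_inner M (p w) (p w') ^ n \<le> exp (?Y w')"
        by (simp add: power_mono exp_of_nat_mult)
      then show ?thesis
        using True w(1) \<open>0 \<le> _\<close> by (simp add: f'_def ennreal_power ennreal_leI)
    qed simp
    have "(\<lambda>w'. L2_inner M (f' w') (f' w)) \<in> borel_measurable P"
      by (intro measurable_compose[OF f'P] measurable_L2_inner L2_densitiesD(1) f'd)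
    then have meas: "(\<lambda>w'. ennreal (L2_inner M (f' w) (f' w')) ^ n) \<in> borel_measurable P"
      by (simp add: L2_inner_commute[of M "f' w"])
    have "(\<integral>\<^sup>+w'. ennreal (L2_inner M (f' w) (f' w')) ^ n \<partial>Q') =
        (\<integral>\<^sup>+w'. ennreal (L2_inner M (f' w) (f' w')) ^ n * indicator E w' \<partial>P) / emeasure P E"
      unfolding Q'_def by (rule nn_integral_uniform_measure[OF meas E(1)])
    also have "\<dots> \<le> (\<integral>\<^sup>+w'. ennreal (exp (?Y w')) \<partial>P) / emeasure P E"
      by (intro divide_right_mono_ennreal nn_integral_mono le)
    also have "\<dots> \<le> ennreal (exp ?V) / emeasure P E"
      by (intro divide_right_mono_ennreal expY)
    also have "\<dots> = ennreal ?B" using E(2) by (simp add: Pe divide_ennreal)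
    finally show ?thesis .
  qed
  obtain g where g: "g \<in> borel_measurable (power_law n M)"
    and eq: "mixture = density (power_law n M) g"
    and gg: "(\<integral>\<^sup>+z. g z * g z \<partial>power_law n M) =
       (\<integral>\<^sup>+w. (\<integral>\<^sup>+w'. ennreal (L2_inner M (f' w) (f' w')) ^ n \<partial>Q') \<partial>Q')"
    by (rule mixture_density)
  have "(\<integral>\<^sup>+w. (\<integral>\<^sup>+w'. ennreal (L2_inner M (f' w) (f' w')) ^ n \<partial>Q') \<partial>Q') \<le> (\<integral>\<^sup>+w. ennreal ?B \<partial>Q')"
  proof (rule nn_integral_mono_AE)
    have *: "AE w in P. w \<in> E \<longrightarrow>
        (\<integral>\<^sup>+w'. ennreal (L2_inner M (f' w) (f' w')) ^ n \<partial>Q') \<le> ennreal ?B"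
      using good by eventually_elim (blast intro: inner)
    show "AE w in Q'. (\<integral>\<^sup>+w'. ennreal (L2_inner M (f' w) (f' w')) ^ n \<partial>Q') \<le> ennreal ?B"
      using AE_uniform_measureI[OF E(1) *] unfolding Q'_def .
  qed
  also have "\<dots> = ennreal ?B" by (simp add: Q.emeasure_space_1)
  finally have gB: "(\<integral>\<^sup>+z. g z * g z \<partial>power_law n M) \<le> ennreal ?B" unfolding gg .
  have "prob_space (power_law n M)" unfolding power_law_def by (intro prob_space_PiM M)
  moreover have "prob_space (density (power_law n M) g)"
    using prob_space_mixture by (simp add: eq)
  ultimately have "(tv_dist (power_law n M) (density (power_law n M) g))\<^sup>2 \<le> (?B - 1) / 4"
    using E(2) by (intro tv_dist_le_second_moment g gB) auto
  then show ?thesis by (simp add: mix eq)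
qed

theorem lemma11:
  fixes MX :: "'x measure" and MY :: "'y measure"
    and J :: "'j set" and K :: "'k set"
    and bX :: "'j \<Rightarrow> 'x \<Rightarrow> real" and bY :: "'k \<Rightarrow> 'y \<Rightarrow> real"
    and j0 :: 'j and k0 :: 'k and n :: nat
    and a :: "'j \<Rightarrow> 'k \<Rightarrow> real"
    and P :: "'w measure" and \<xi> :: "'j \<Rightarrow> 'k \<Rightarrow> 'w \<Rightarrow> real"
    and p :: "'w \<Rightarrow> 'x \<times> 'y \<Rightarrow> real"
    and Q :: "'v measure" and f :: "'v \<Rightarrow> 'x \<times> 'y \<Rightarrow> real"
  defines "\<mu> \<equiv> MX \<Otimes>\<^sub>M MY"
    and "I \<equiv> (J - {j0}) \<times> (K - {k0})"
    and "E \<equiv> {w \<in> space P. p w \<in> L2_densities (MX \<Otimes>\<^sub>M MY)}"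
  assumes "prob_space MX" and "prob_space MY"
    and "separable_measure MX" and "separable_measure MY"
    and "countable J" and "countable K"
    and "orthonormal_basis_L2 MX J bX" and "orthonormal_basis_L2 MY K bY"
    and "j0 \<in> J" and "k0 \<in> K"
    and "\<And>x. x \<in> space MX \<Longrightarrow> bX j0 x = 1" and "\<And>y. y \<in> space MY \<Longrightarrow> bY k0 y = 1"
    and "(\<lambda>(j, k). (a j k)\<^sup>2) summable_on I"
    and "prob_space P"
    and "\<And>j k. (j, k) \<in> I \<Longrightarrow> rademacher P (\<xi> j k)"
    and "prob_space.indep_vars P (\<lambda>_. borel) (\<lambda>(j, k). \<xi> j k) I"
    and "p \<in> P \<rightarrow>\<^sub>M L2_borel \<mu>"
    and "AE w in P. has_L2_sum \<mu> (\<lambda>(j, k) z. a j k * \<xi> j k w * tensor bX bY j k z) I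
           (\<lambda>z. p w z - tensor bX bY j0 k0 z)"
    and "E \<in> sets P" and "measure P E > 0"
    and "prob_space Q"
    and "f \<in> Q \<rightarrow>\<^sub>M L2_borel \<mu>" and "\<And>v. v \<in> space Q \<Longrightarrow> f v \<in> L2_densities \<mu>"
    and "distr Q (L2_borel \<mu>) f = distr (uniform_measure P E) (L2_borel \<mu>) p"
  shows "(tv_dist (power_law n (density_law \<mu> (tensor bX bY j0 k0))) (mixture_law Q n \<mu> f))\<^sup>2
    \<le> exp ((real n + 1)\<^sup>2 / 2 * (\<Sum>\<^sub>\<infinity>(j, k)\<in>I. (a j k) ^ 4)) / (4 * (measure P E)\<^sup>2) - 1 / 4"
proof -
  interpret X: prob_space MX by fact
  interpret Y: prob_space MY by fact
  interpret XY: pair_prob_space MX MY ..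
  interpret P: prob_space P by fact
  define e where "e = (\<lambda>(j, k). tensor bX bY j k)"
  let ?e0 = "tensor bX bY j0 k0" and ?S = "\<Sum>\<^sub>\<infinity>(j, k)\<in>I. (a j k) ^ 4"
  have M: "prob_space \<mu>" unfolding \<mu>_def by (rule XY.prob_space_axioms)
  have bX: "bX j \<in> L2 MX" "j' \<in> J \<Longrightarrow> L2_inner MX (bX j) (bX j') = (if j = j' then 1 else 0)"
    if "j \<in> J" for j j'
    using \<open>orthonormal_basis_L2 MX J bX\<close> that by (auto simp: orthonormal_basis_L2_def)
  have bY: "bY k \<in> L2 MY" "k' \<in> K \<Longrightarrow> L2_inner MY (bY k) (bY k') = (if k = k' then 1 else 0)"
    if "k \<in> K" for k k'
    using \<open>orthonormal_basis_L2 MY K bY\<close> that by (auto simp: orthonormal_basis_L2_def)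
  have tensor_L2: "tensor bX bY j k \<in> L2 \<mu>" if "j \<in> J" "k \<in> K" for j k
    using L2_inner_product_functions(2)[OF X.prob_space_axioms Y.prob_space_axioms]
      bX(1)[OF that(1)] bY(1)[OF that(2)]
    unfolding \<mu>_def tensor_def[abs_def] by blast
  have tensor_inner: "L2_inner \<mu> (tensor bX bY j k) (tensor bX bY j' k') =
      (if (j, k) = (j', k') then 1 else 0)" if "j \<in> J" "k \<in> K" "j' \<in> J" "k' \<in> K" for j k j' k'
    unfolding \<mu>_def tensor_def[abs_def]
    using that
    by (subst L2_inner_product_functions(1)[OF X.prob_space_axioms Y.prob_space_axioms])
       (auto simp: bX bY)
  have e0: "?e0 \<in> borel_measurable \<mu>" "\<And>z. z \<in> space \<mu> \<Longrightarrow> ?e0 z = 1"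
    using tensor_L2 assms by (auto simp: tensor_def \<mu>_def space_pair_measure intro: L2_measurable)
  have null: "density_law \<mu> ?e0 = \<mu>"
    unfolding density_law_def using e0
    by (subst density_cong[of _ _ "\<lambda>_. 1"]) (auto simp: density_1)
  have indep: "P.indep_vars (\<lambda>_. borel) (\<lambda>i. case_prod \<xi> i) I"
    using \<open>P.indep_vars (\<lambda>_. borel) (\<lambda>(j, k). \<xi> j k) I\<close> by (simp add: case_prod_beta')
  have series: "AE w in P. has_L2_sum \<mu> (\<lambda>i z. (case_prod a i * case_prod \<xi> i w) * e i z) I
      (\<lambda>z. p w z - ?e0 z)"
    using \<open>AE w in P. has_L2_sum \<mu> _ I _\<close> by (simp add: e_def case_prod_beta')
  have mix: "L2_mixture Q \<mu> f"
    by (intro L2_mixture.intro L2_mixture_axioms.intro M assms)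
  have tv: "(tv_dist (power_law n \<mu>) (mixture_law Q n \<mu> f))\<^sup>2
      \<le> (exp ((real n)\<^sup>2 / 2 * (\<Sum>\<^sub>\<infinity>i\<in>I. (case_prod a i) ^ 4)) / measure P E - 1) / 4"
    unfolding E_def \<mu>_def[symmetric]
  proof (rule rademacher_mixture_tv_bound[OF M _ _ _ e0 _ P.prob_space_axioms _ indep _ series _ _ mix])
    show "countable I" using assms by (auto simp: I_def)
    show "e i \<in> L2 \<mu>" if "i \<in> I" for i
      using that tensor_L2 by (auto simp: e_def I_def)
    show "L2_inner \<mu> (e i) (e i') = (if i = i' then 1 else 0)" if "i \<in> I" "i' \<in> I" for i i'
      using that tensor_inner by (auto simp: e_def I_def split: if_splits)
    show "(\<lambda>i. (case_prod a i)\<^sup>2) summable_on I"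
      using \<open>(\<lambda>(j, k). (a j k)\<^sup>2) summable_on I\<close> by (simp add: case_prod_beta')
    show "rademacher P (case_prod \<xi> i)" if "i \<in> I" for i
      using that assms by (cases i) auto
  qed (use assms in \<open>simp_all add: E_def \<mu>_def\<close>)
  have S0: "0 \<le> ?S" by (intro infsum_nonneg) auto
  \<comment> \<open>The bound at hand has \<open>n\<^sup>2\<close> and \<open>P(E)\<close> in place of \<open>(n + 1)\<^sup>2\<close> and \<open>P(E)\<^sup>2\<close>.\<close>
  have "(real n)\<^sup>2 / 2 * ?S \<le> (real n + 1)\<^sup>2 / 2 * ?S"
    using S0 by (intro mult_right_mono divide_right_mono power_mono) auto
  moreover have "(measure P E)\<^sup>2 \<le> measure P E"
    by (simp add: power2_eq_square mult_left_le)
  ultimately have "exp ((real n)\<^sup>2 / 2 * ?S) / measure P E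
      \<le> exp ((real n + 1)\<^sup>2 / 2 * ?S) / (measure P E)\<^sup>2"
    using \<open>measure P E > 0\<close> by (intro frac_le) auto
  with tv show ?thesis unfolding null by (simp add: case_prod_beta' diff_divide_distrib)
qed

end
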